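(* Let $n\ge1$. Let $B(K_n)$ be the group generated by $a_1,\dots,a_n$ subject to the relations $a_ia_ja_i=a_ja_ia_j$ for all $i\ne j$, and let $B(A_n)$ be the braid group generated by $\sigma_1,\dots,\sigma_n$ subject to $\sigma_i\sigma_{i+1}\sigma_i=\sigma_{i+1}\sigma_i\sigma_{i+1}$ ($1\le i\le n-1$) and $\sigma_i\sigma_j=\sigma_j\sigma_i$ if $|i-j|>1$. Define $c_n:=\sigma_n$ and $c_k:=\sigma_k^{-1}c_{k+1}\sigma_k$ for $1\le k\le n-1$. Then the assignment $\eta: a_i\mapsto c_i$ ($1\le i\le n$) defines a surjective group homomorphism $\eta:B(K_n)\to B(A_n)$. *)

theory Defs
  imports "HOL-Algebra.Algebra"
begin

section \<open>Group presentations\<close>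

datatype 'a letter = Pos 'a | Neg 'a

definition words :: "'a set \<Rightarrow> 'a letter list set"
  where "words S = lists (Pos ` S \<union> Neg ` S)"

text \<open>The least congruence on the words over \<open>S\<close> under which \<open>Neg x\<close> is the two-sided
  inverse of \<open>Pos x\<close> and in which \<open>u\<close> and \<open>v\<close> are identified for every relation \<open>u = v\<close>,
  given as the pair \<open>(u, v)\<close> in \<open>R\<close>.\<close>

inductive_set pres_rel :: "'a set \<Rightarrow> 'a letter list rel \<Rightarrow> 'a letter list rel"
  for S :: "'a set" and R :: "'a letter list rel"
  where
    refl: "w \<in> words S \<Longrightarrow> (w, w) \<in> pres_rel S R"
  | sym: "(u, v) \<in> pres_rel S R \<Longrightarrow> (v, u) \<in> pres_rel S R"
  | trans: "(u, v) \<in> pres_rel S R \<Longrightarrow> (v, w) \<in> pres_rel S R \<Longrightarrow> (u, w) \<in> pres_rel S R"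
  | append: "(u, u') \<in> pres_rel S R \<Longrightarrow> (v, v') \<in> pres_rel S R \<Longrightarrow> (u @ v, u' @ v') \<in> pres_rel S R"
  | Pos_Neg: "x \<in> S \<Longrightarrow> ([Pos x, Neg x], []) \<in> pres_rel S R"
  | Neg_Pos: "x \<in> S \<Longrightarrow> ([Neg x, Pos x], []) \<in> pres_rel S R"
  | relation: "(u, v) \<in> R \<Longrightarrow> u \<in> words S \<Longrightarrow> v \<in> words S \<Longrightarrow> (u, v) \<in> pres_rel S R"

definition pres_class :: "'a set \<Rightarrow> 'a letter list rel \<Rightarrow> 'a letter list \<Rightarrow> 'a letter list set"
  where "pres_class S R w = pres_rel S R `` {w}"

definition presented_group :: "'a set \<Rightarrow> 'a letter list rel \<Rightarrow> 'a letter list set monoid"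
  where "presented_group S R =
    \<lparr>carrier = words S // pres_rel S R,
     monoid.mult = (\<lambda>A B. \<Union>u\<in>A. \<Union>v\<in>B. pres_class S R (u @ v)),
     monoid.one = pres_class S R []\<rparr>"

lemma words_append: "u \<in> words S \<Longrightarrow> v \<in> words S \<Longrightarrow> u @ v \<in> words S"
  by (simp add: words_def)

lemma pres_rel_words: "(u, v) \<in> pres_rel S R \<Longrightarrow> u \<in> words S \<and> v \<in> words S"
  by (induction rule: pres_rel.induct) (auto simp: words_def)

lemma equiv_pres_rel: "equiv (words S) (pres_rel S R)"
proof (rule equivI)
  show "pres_rel S R \<subseteq> words S \<times> words S"
    by (auto dest: pres_rel_words)
  show "refl_on (words S) (pres_rel S R)"
    by (rule refl_onI) (rule pres_rel.refl)
  show "sym (pres_rel S R)"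
    by (rule symI) (rule pres_rel.sym)
  show "trans (pres_rel S R)"
    by (rule transI) (rule pres_rel.trans)
qed

lemma pres_class_eq_iff:
  "u \<in> words S \<Longrightarrow> v \<in> words S \<Longrightarrow> pres_class S R u = pres_class S R v \<longleftrightarrow> (u, v) \<in> pres_rel S R"
  unfolding pres_class_def by (rule eq_equiv_class_iff[OF equiv_pres_rel])

lemma carrier_presented_group: "carrier (presented_group S R) = pres_class S R ` words S"
  by (auto simp: presented_group_def pres_class_def quotient_def)

lemma one_presented_group: "\<one>\<^bsub>presented_group S R\<^esub> = pres_class S R []"
  by (simp add: presented_group_def)

lemma mult_presented_group:
  assumes u: "u \<in> words S" and v: "v \<in> words S"
  shows "pres_class S R u \<otimes>\<^bsub>presented_group S R\<^esub> pres_class S R v = pres_class S R (u @ v)"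
proof -
  have *: "pres_class S R (u' @ v') = pres_class S R (u @ v)"
    if "u' \<in> pres_class S R u" "v' \<in> pres_class S R v" for u' v'
  proof -
    have r: "(u, u') \<in> pres_rel S R" "(v, v') \<in> pres_rel S R"
      using that by (auto simp: pres_class_def)
    then have "(u' @ v', u @ v) \<in> pres_rel S R"
      by (rule pres_rel.sym[OF pres_rel.append])
    then show ?thesis
      using pres_rel_words[of "u' @ v'" "u @ v"] by (simp add: pres_class_eq_iff)
  qed
  have ne: "u \<in> pres_class S R u" "v \<in> pres_class S R v"
    using u v by (auto simp: pres_class_def intro: pres_rel.refl)
  have "(\<Union>u'\<in>pres_class S R u. \<Union>v'\<in>pres_class S R v. pres_class S R (u' @ v')) =
      (\<Union>u'\<in>pres_class S R u. \<Union>v'\<in>pres_class S R v. pres_class S R (u @ v))"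
    by (intro SUP_cong HOL.refl *)
  also have "\<dots> = pres_class S R (u @ v)"
    using ne by blast
  finally show ?thesis
    by (simp add: presented_group_def)
qed

lemma pres_rel_left_inverse:
  "w \<in> words S \<Longrightarrow> \<exists>w'\<in>words S. (w' @ w, []) \<in> pres_rel S R"
proof (induction w)
  case Nil
  then show ?case by (auto intro: pres_rel.refl)
next
  case (Cons x w)
  then have w: "w \<in> words S" by (simp add: words_def)
  with Cons.IH obtain w' where w': "w' \<in> words S" "(w' @ w, []) \<in> pres_rel S R" by blast
  obtain y where y: "[y] \<in> words S" "([y, x], []) \<in> pres_rel S R"
    using Cons.prems by (auto simp: words_def intro: pres_rel.Pos_Neg pres_rel.Neg_Pos)
  have "(w' @ ([y, x] @ w), w' @ ([] @ w)) \<in> pres_rel S R"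
    using w w' y by (intro pres_rel.append pres_rel.refl)
  then have "((w' @ [y]) @ x # w, []) \<in> pres_rel S R"
    by (simp add: pres_rel.trans[OF _ w'(2)])
  then show ?case
    using words_append[OF w'(1) y(1)] by blast
qed

lemma group_presented_group: "group (presented_group S R)"
proof (rule groupI)
  have nil: "[] \<in> words S" by (simp add: words_def)
  show "\<one>\<^bsub>presented_group S R\<^esub> \<in> carrier (presented_group S R)"
    using nil by (simp add: carrier_presented_group one_presented_group)
  show "\<one>\<^bsub>presented_group S R\<^esub> \<otimes>\<^bsub>presented_group S R\<^esub> x = x"
    if "x \<in> carrier (presented_group S R)" for x
    using that nil
    by (auto simp: carrier_presented_group one_presented_group mult_presented_group)
  show "\<exists>y\<in>carrier (presented_group S R).
      y \<otimes>\<^bsub>presented_group S R\<^esub> x = \<one>\<^bsub>presented_group S R\<^esub>"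
    if x: "x \<in> carrier (presented_group S R)" for x
  proof -
    obtain w where w: "w \<in> words S" "x = pres_class S R w"
      using x by (auto simp: carrier_presented_group)
    obtain w' where w': "w' \<in> words S" "(w' @ w, []) \<in> pres_rel S R"
      using pres_rel_left_inverse[OF w(1)] by blast
    then have "pres_class S R w' \<otimes>\<^bsub>presented_group S R\<^esub> x = \<one>\<^bsub>presented_group S R\<^esub>"
      using w nil
      by (simp add: mult_presented_group one_presented_group pres_class_eq_iff words_append)
    then show ?thesis
      using w'(1) by (auto simp: carrier_presented_group)
  qed
qed (auto simp: carrier_presented_group mult_presented_group words_append)

definition gen :: "'a set \<Rightarrow> 'a letter list rel \<Rightarrow> 'a \<Rightarrow> 'a letter list set"
  where "gen S R x = pres_class S R [Pos x]"


section \<open>The groups of types \<open>K\<^sub>n\<close> and \<open>A\<^sub>n\<close>\<close>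

definition K_relations :: "nat \<Rightarrow> nat letter list rel"
  where "K_relations n =
    {([Pos i, Pos j, Pos i], [Pos j, Pos i, Pos j]) | i j. i \<in> {1..n} \<and> j \<in> {1..n} \<and> i \<noteq> j}"

definition A_relations :: "nat \<Rightarrow> nat letter list rel"
  where "A_relations n =
    {([Pos i, Pos (i + 1), Pos i], [Pos (i + 1), Pos i, Pos (i + 1)]) | i. 1 \<le> i \<and> i + 1 \<le> n} \<union>
    {([Pos i, Pos j], [Pos j, Pos i]) | i j. i \<in> {1..n} \<and> j \<in> {1..n} \<and> \<bar>int i - int j\<bar> > 1}"

definition B_K :: "nat \<Rightarrow> nat letter list set monoid"
  where "B_K n = presented_group {1..n} (K_relations n)"

definition B_A :: "nat \<Rightarrow> nat letter list set monoid"
  where "B_A n = presented_group {1..n} (A_relations n)"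

definition K_gen :: "nat \<Rightarrow> nat \<Rightarrow> nat letter list set"
  where "K_gen n i = gen {1..n} (K_relations n) i"

definition A_gen :: "nat \<Rightarrow> nat \<Rightarrow> nat letter list set"
  where "A_gen n i = gen {1..n} (A_relations n) i"

text \<open>Only the values for \<open>1 \<le> k \<le> n\<close> are meaningful.\<close>

function c_elt :: "nat \<Rightarrow> nat \<Rightarrow> nat letter list set"
  where "c_elt n k =
    (if k \<ge> n then A_gen n n
     else inv\<^bsub>B_A n\<^esub> (A_gen n k) \<otimes>\<^bsub>B_A n\<^esub> c_elt n (k + 1) \<otimes>\<^bsub>B_A n\<^esub> A_gen n k)"
  by auto
termination by (relation "measure (\<lambda>(n, k). n - k)") simp_all

declare c_elt.simps [simp del]

lemma group_B_K: "group (B_K n)"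
  unfolding B_K_def by (rule group_presented_group)

lemma group_B_A: "group (B_A n)"
  unfolding B_A_def by (rule group_presented_group)

end

theory Submission imports Defs begin

text \<open>The braid relation between \<open>\<sigma>\<^sub>k\<close> and \<open>c\<^bsub>k+1\<^esub>\<close> turns the definition of \<open>c\<^sub>k\<close> into
  \<open>c\<^sub>k = c\<^bsub>k+1\<^esub> \<sigma>\<^sub>k c\<^bsub>k+1\<^esub>\<^sup>-\<^sup>1\<close>. This carries the braid relation for the pair
  \<open>\<sigma>\<^bsub>k-1\<^esub>, \<sigma>\<^sub>k\<close> to one for \<open>\<sigma>\<^bsub>k-1\<^esub>, c\<^sub>k\<close>, because \<open>\<sigma>\<^bsub>k-1\<^esub>\<close> commutes with \<open>c\<^bsub>k+1\<^esub>\<close>, and the one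
  for \<open>\<sigma>\<^sub>k, c\<^bsub>k+1\<^esub>\<close> to one for \<open>c\<^sub>k, c\<^bsub>k+1\<^esub>\<close>. The braid relation for \<open>c\<^sub>k, c\<^sub>j\<close> with \<open>j > k + 1\<close>
  is the one for \<open>c\<^bsub>k+1\<^esub>, c\<^sub>j\<close> conjugated by \<open>\<sigma>\<^sub>k\<close>, which commutes with \<open>c\<^sub>j\<close>. Finally
  \<open>\<sigma>\<^sub>k = c\<^bsub>k+1\<^esub>\<^sup>-\<^sup>1 c\<^sub>k c\<^bsub>k+1\<^esub>\<close>, so the \<open>c\<^sub>k\<close> generate \<open>B(A\<^sub>n)\<close>.\<close>

section \<open>Homomorphisms out of a presented group\<close>

text \<open>Evaluation of words under an assignment of the generators. The group is an explicit
  argument because words are evaluated both in the presented group and in the target.\<close>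

fun letter_val :: "('b, 'c) monoid_scheme \<Rightarrow> ('a \<Rightarrow> 'b) \<Rightarrow> 'a letter \<Rightarrow> 'b"
  where
    "letter_val G f (Pos x) = f x"
  | "letter_val G f (Neg x) = inv\<^bsub>G\<^esub> f x"

fun word_val :: "('b, 'c) monoid_scheme \<Rightarrow> ('a \<Rightarrow> 'b) \<Rightarrow> 'a letter list \<Rightarrow> 'b"
  where
    "word_val G f [] = \<one>\<^bsub>G\<^esub>"
  | "word_val G f (l # w) = letter_val G f l \<otimes>\<^bsub>G\<^esub> word_val G f w"

lemma Nil_in_words [simp]: "[] \<in> words S"
  by (simp add: words_def)

lemma Cons_in_words_iff [simp]:
  "l # w \<in> words S \<longleftrightarrow> l \<in> Pos ` S \<union> Neg ` S \<and> w \<in> words S"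
  by (simp add: words_def)

lemma gen_closed: "x \<in> S \<Longrightarrow> gen S R x \<in> carrier (presented_group S R)"
  by (auto simp: gen_def carrier_presented_group)

lemma pres_class_Neg:
  assumes "x \<in> S"
  shows "pres_class S R [Neg x] = inv\<^bsub>presented_group S R\<^esub> gen S R x"
proof -
  interpret group "presented_group S R" by (rule group_presented_group)
  have "pres_class S R [Neg x] \<otimes>\<^bsub>presented_group S R\<^esub> gen S R x = \<one>\<^bsub>presented_group S R\<^esub>"
    using assms by (simp add: gen_def mult_presented_group one_presented_group pres_class_eq_iff
      pres_rel.Neg_Pos)
  then show ?thesis
    using assms by (intro inv_equality[symmetric]) (auto simp: gen_closed, simp add: carrier_presented_group)
qed

text \<open>Splitting off one letter at a time writes a class as a product of generators and their
  inverses, so claims about the quotient reduce to inductions on words.\<close>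

lemma pres_class_eq_word_val:
  assumes "w \<in> words S"
  shows "pres_class S R w = word_val (presented_group S R) (gen S R) w"
  using assms
proof (induction w)
  case Nil
  show ?case by (simp add: one_presented_group)
next
  case (Cons l w)
  have "pres_class S R [l] = letter_val (presented_group S R) (gen S R) l"
    using Cons.prems by (auto simp: gen_def[symmetric] pres_class_Neg)
  moreover have "pres_class S R (l # w) = pres_class S R [l] \<otimes>\<^bsub>presented_group S R\<^esub> pres_class S R w"
    using Cons.prems by (simp add: mult_presented_group)
  ultimately show ?case
    using Cons by simp
qed

lemma presented_group_relation:
  assumes "(u, v) \<in> R" "u \<in> words S" "v \<in> words S"
  shows "word_val (presented_group S R) (gen S R) u = word_val (presented_group S R) (gen S R) v"
  using assms by (simp add: pres_class_eq_word_val[symmetric] pres_class_eq_iff pres_rel.relation)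

context group
begin

lemma letter_val_closed:
  "f ` S \<subseteq> carrier G \<Longrightarrow> l \<in> Pos ` S \<union> Neg ` S \<Longrightarrow> letter_val G f l \<in> carrier G"
  by auto

lemma word_val_closed:
  assumes "f ` S \<subseteq> carrier G" "w \<in> words S"
  shows "word_val G f w \<in> carrier G"
  using assms(2)
proof (induction w)
  case (Cons l w)
  then show ?case using letter_val_closed[OF assms(1), of l] by simp
qed simp

lemma word_val_append:
  assumes f: "f ` S \<subseteq> carrier G" and "u \<in> words S" "v \<in> words S"
  shows "word_val G f (u @ v) = word_val G f u \<otimes> word_val G f v"
  using assms(2)
proof (induction u)
  case Nil
  show ?case using word_val_closed[OF f assms(3)] by simp
next
  case (Cons l u)
  then show ?case
    using letter_val_closed[OF f, of l] word_val_closed[OF f] assms(3) by (simp add: m_assoc)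
qed

text \<open>Each rule generating the congruence becomes a true equation after evaluation in a group;
  \<open>R\<close> covers the defining relations.\<close>

lemma word_val_pres_rel:
  assumes f: "f ` S \<subseteq> carrier G"
    and R: "\<And>u v. (u, v) \<in> R \<Longrightarrow> u \<in> words S \<Longrightarrow> v \<in> words S \<Longrightarrow> word_val G f u = word_val G f v"
    and "(u, v) \<in> pres_rel S R"
  shows "word_val G f u = word_val G f v"
  using assms(3)
proof (induction rule: pres_rel.induct)
  case (append u u' v v')
  then show ?case
    using pres_rel_words[of u u' S R] pres_rel_words[of v v' S R]
    by (simp add: word_val_append[OF f])
next
  case (Pos_Neg x)
  then have "f x \<in> carrier G" using f by auto
  then show ?case by simp
next
  case (Neg_Pos x)
  then have "f x \<in> carrier G" using f by auto
  then show ?case by simp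
qed (auto intro: R)

text \<open>Von Dyck's theorem. Evaluation is constant on classes and turns concatenation into
  multiplication, so it descends to the quotient.\<close>

lemma presented_group_lift:
  assumes f: "f ` S \<subseteq> carrier G"
    and R: "\<And>u v. (u, v) \<in> R \<Longrightarrow> u \<in> words S \<Longrightarrow> v \<in> words S \<Longrightarrow> word_val G f u = word_val G f v"
  obtains h where "group_hom (presented_group S R) G h"
    and "\<And>x. x \<in> S \<Longrightarrow> h (gen S R x) = f x"
proof -
  \<comment> \<open>A class is a set of words. Any representative will do, since evaluation does not
    depend on the choice.\<close>
  define h where "h A = word_val G f (SOME w. w \<in> A)" for A
  have h: "h (pres_class S R w) = word_val G f w" if "w \<in> words S" for w
  proof -
    have "w \<in> pres_class S R w"
      using that by (simp add: pres_class_def pres_rel.refl)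
    then have "(SOME v. v \<in> pres_class S R w) \<in> pres_class S R w"
      by (rule someI)
    then have "(w, SOME v. v \<in> pres_class S R w) \<in> pres_rel S R"
      by (simp add: pres_class_def)
    then show ?thesis
      using word_val_pres_rel[OF f R] by (simp add: h_def)
  qed
  have "h \<in> hom (presented_group S R) G"
    by (rule homI) (auto simp: carrier_presented_group h mult_presented_group words_append
      word_val_append[OF f] word_val_closed[OF f])
  then have "group_hom (presented_group S R) G h"
    by (simp add: group_hom_def group_hom_axioms_def group_presented_group is_group)
  moreover have "h (gen S R x) = f x" if "x \<in> S" for x
    using that f by (auto simp: gen_def h)
  ultimately show thesis
    using that by blast
qed

lemma subgroup_word_val_closed:
  assumes H: "subgroup H G" and "f ` S \<subseteq> H" "w \<in> words S"
  shows "word_val G f w \<in> H"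
  using assms(3)
proof (induction w)
  case Nil
  show ?case using H by (simp add: subgroup.one_closed)
next
  case (Cons l w)
  then have "letter_val G f l \<in> H"
    using assms(2) by (auto intro!: subgroup.m_inv_closed[OF H])
  with Cons show ?case
    using H by (simp add: subgroup.m_closed)
qed

end

section \<open>Generation of a presented group and uniqueness of homomorphisms out of it\<close>

lemma subgroup_presented_group_eqI:
  assumes "subgroup H (presented_group S R)" "gen S R ` S \<subseteq> H"
  shows "H = carrier (presented_group S R)"
proof
  show "H \<subseteq> carrier (presented_group S R)"
    using assms(1) by (rule subgroup.subset)
  show "carrier (presented_group S R) \<subseteq> H"
    using group.subgroup_word_val_closed[OF group_presented_group assms]
    by (auto simp: carrier_presented_group pres_class_eq_word_val)
qed

lemma hom_word_val:
  assumes "group_hom G H h" "f ` S \<subseteq> carrier G" "w \<in> words S"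
  shows "h (word_val G f w) = word_val H (h \<circ> f) w"
proof -
  interpret group_hom G H h by fact
  have "h (letter_val G f l) = letter_val H (h \<circ> f) l" if "l \<in> Pos ` S \<union> Neg ` S" for l
    using that assms(2) by (auto simp: image_subset_iff)
  then show ?thesis
    using assms(3)
  proof (induction w)
    case (Cons l w)
    then show ?case
      using G.letter_val_closed[OF assms(2), of l] G.word_val_closed[OF assms(2), of w] by simp
  qed simp
qed

lemma word_val_cong:
  "w \<in> words S \<Longrightarrow> (\<And>x. x \<in> S \<Longrightarrow> f x = g x) \<Longrightarrow> word_val G f w = word_val G g w"
  by (induction w) auto

text \<open>Every element is the value of a word, and both maps send it to the value of that word at
  the images of the generators.\<close>

lemma presented_group_hom_eqI:
  assumes "group_hom (presented_group S R) H h" "group_hom (presented_group S R) H h'"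
    and "\<And>x. x \<in> S \<Longrightarrow> h (gen S R x) = h' (gen S R x)"
    and "a \<in> carrier (presented_group S R)"
  shows "h a = h' a"
proof -
  obtain w where w: "w \<in> words S" "a = word_val (presented_group S R) (gen S R) w"
    using assms(4) by (auto simp: carrier_presented_group pres_class_eq_word_val)
  have "gen S R ` S \<subseteq> carrier (presented_group S R)"
    by (auto intro: gen_closed)
  then show ?thesis
    using w assms(3) word_val_cong[OF w(1), of "h \<circ> gen S R" "h' \<circ> gen S R" H]
    by (simp add: hom_word_val[OF assms(1)] hom_word_val[OF assms(2)])
qed


section \<open>Braid relations under conjugation\<close>

definition braided :: "('a, 'b) monoid_scheme \<Rightarrow> 'a \<Rightarrow> 'a \<Rightarrow> bool"
  where "braided G x y \<longleftrightarrow> x \<otimes>\<^bsub>G\<^esub> y \<otimes>\<^bsub>G\<^esub> x = y \<otimes>\<^bsub>G\<^esub> x \<otimes>\<^bsub>G\<^esub> y"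

lemma braided_sym: "braided G x y \<Longrightarrow> braided G y x"
  by (simp add: braided_def)

context group
begin

lemma inv_mult_cancel: "x \<in> carrier G \<Longrightarrow> y \<in> carrier G \<Longrightarrow> inv x \<otimes> (x \<otimes> y) = y"
  by (simp add: m_assoc[symmetric])

lemma mult_inv_cancel: "x \<in> carrier G \<Longrightarrow> y \<in> carrier G \<Longrightarrow> x \<otimes> (inv x \<otimes> y) = y"
  by (simp add: m_assoc[symmetric])

lemma conj_mult:
  assumes "g \<in> carrier G" "x \<in> carrier G" "y \<in> carrier G"
  shows "(inv g \<otimes> x \<otimes> g) \<otimes> (inv g \<otimes> y \<otimes> g) = inv g \<otimes> (x \<otimes> y) \<otimes> g"
  using assms by (simp add: m_assoc mult_inv_cancel)

lemma braided_conj: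
  assumes "g \<in> carrier G" "x \<in> carrier G" "y \<in> carrier G" "braided G x y"
  shows "braided G (inv g \<otimes> x \<otimes> g) (inv g \<otimes> y \<otimes> g)"
  using assms by (simp add: braided_def conj_mult)

lemma conj_commuting:
  assumes "g \<in> carrier G" "x \<in> carrier G" "g \<otimes> x = x \<otimes> g"
  shows "inv g \<otimes> x \<otimes> g = x"
proof -
  have "inv g \<otimes> x \<otimes> g = inv g \<otimes> (x \<otimes> g)"
    using assms(1,2) by (simp add: m_assoc)
  also have "\<dots> = inv g \<otimes> (g \<otimes> x)"
    by (simp only: assms(3))
  also have "\<dots> = x"
    using assms(1,2) by (rule inv_mult_cancel)
  finally show ?thesis .
qed

lemma conj_inv_commuting:
  assumes "g \<in> carrier G" "x \<in> carrier G" "g \<otimes> x = x \<otimes> g"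
  shows "g \<otimes> x \<otimes> inv g = x"
  using assms(1,2) by (simp add: assms(3)) (simp add: m_assoc)

text \<open>Multiply \<open>y x y = x y x\<close> by the inverse of \<open>x\<close> on the left and
  that of \<open>y\<close> on the right.\<close>

lemma braided_conj_swap:
  assumes "x \<in> carrier G" "y \<in> carrier G" "braided G x y"
  shows "inv x \<otimes> y \<otimes> x = y \<otimes> x \<otimes> inv y"
proof -
  have "x \<otimes> (y \<otimes> x \<otimes> inv y) = (x \<otimes> y \<otimes> x) \<otimes> inv y"
    using assms by (simp add: m_assoc)
  also have "\<dots> = (y \<otimes> x \<otimes> y) \<otimes> inv y"
    using assms(3) by (simp add: braided_def)
  also have "\<dots> = y \<otimes> x"
    using assms by (simp add: m_assoc)
  finally have "inv x \<otimes> (y \<otimes> x) = y \<otimes> x \<otimes> inv y"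
    using assms inv_mult_cancel by (metis inv_closed m_closed)
  then show ?thesis
    using assms by (simp add: m_assoc)
qed

end


section \<open>The conjugates \<open>c\<^sub>k\<close>\<close>

text \<open>Isolates what is used about \<sigma>_i and c_i, so that the computations take place in
  an abstract group rather than with classes of words.\<close>

locale braid_generators = group G for G (structure) +
  fixes n :: nat and s c :: "nat \<Rightarrow> 'a"
  assumes s_closed: "k \<in> {1..n} \<Longrightarrow> s k \<in> carrier G"
    and s_braided: "1 \<le> k \<Longrightarrow> k < n \<Longrightarrow> braided G (s k) (s (Suc k))"
    and s_commute: "1 \<le> i \<Longrightarrow> Suc i < j \<Longrightarrow> j \<le> n \<Longrightarrow> s i \<otimes> s j = s j \<otimes> s i"
    and c_last: "c n = s n"
    and c_step: "1 \<le> k \<Longrightarrow> k < n \<Longrightarrow> c k = inv (s k) \<otimes> c (Suc k) \<otimes> s k"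
begin

lemma c_closed:
  assumes "1 \<le> k" "k \<le> n"
  shows "c k \<in> carrier G"
  using assms(2,1)
proof (induction k rule: inc_induct)
  case base
  then show ?case by (simp add: c_last s_closed)
next
  case (step k)
  then show ?case by (simp add: c_step s_closed)
qed

text \<open>\<open>c j\<close> is built from \<open>s j\<close>, ..., \<open>s n\<close>, all of
  which commute with \<open>s i\<close>. The induction descends from \<open>n\<close>, following the
  recursion for \<open>c\<close>.\<close>

lemma s_c_commute:
  assumes "1 \<le> i" "Suc i < j" "j \<le> n"
  shows "s i \<otimes> c j = c j \<otimes> s i"
  using assms(3,2)
proof (induction j rule: inc_induct)
  case base
  then show ?case using assms s_commute[of i n] by (simp add: c_last)
next
  case (step k)
  have cl: "s i \<in> carrier G" "s k \<in> carrier G" "c (Suc k) \<in> carrier G"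
    using assms step by (auto intro: s_closed c_closed)
  have si: "inv s k \<otimes> s i \<otimes> s k = s i"
    using assms step cl by (intro conj_commuting s_commute[symmetric]) auto
  have ck: "c k = inv s k \<otimes> c (Suc k) \<otimes> s k"
    using assms step by (simp add: c_step)
  have ih: "s i \<otimes> c (Suc k) = c (Suc k) \<otimes> s i"
    using step.IH step.prems by linarith
  have "s i \<otimes> c k = inv s k \<otimes> (s i \<otimes> c (Suc k)) \<otimes> s k"
    using conj_mult[OF cl(2,1,3)] by (simp only: si ck[symmetric])
  also have "\<dots> = inv s k \<otimes> (c (Suc k) \<otimes> s i) \<otimes> s k"
    by (simp only: ih)
  also have "\<dots> = c k \<otimes> s i"
    using conj_mult[OF cl(2,3,1)] by (simp only: si ck[symmetric])
  finally show ?case .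
qed

lemma s_c_braided:
  assumes "1 \<le> k" "k < n"
  shows "braided G (s k) (c (Suc k))"
proof -
  \<comment> \<open>The descent starts at \<open>n - 1\<close>, where \<open>c (Suc k)\<close> is
    \<open>c n = s n\<close> and the claim is a defining braid relation.\<close>
  have "k \<le> n - 1"
    using assms by simp
  then show ?thesis
    using assms(1)
  proof (induction k rule: inc_induct)
    case base
    then show ?case using s_braided[of "n - 1"] assms by (simp add: c_last)
  next
    case (step k)
    let ?d = "c (Suc (Suc k))"
    have k: "1 \<le> k" "Suc (Suc k) \<le> n"
      using step.hyps step.prems by auto
    then have cl: "s k \<in> carrier G" "s (Suc k) \<in> carrier G" "?d \<in> carrier G"
      by (auto intro: s_closed c_closed)
    \<comment> \<open>The induction hypothesis, braidedness of \<open>s (Suc k)\<close> and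
      \<open>?d\<close>, swaps the conjugating element. Conjugation by \<open>?d\<close> then sends
      \<open>s (Suc k)\<close> to \<open>c (Suc k)\<close> and fixes \<open>s k\<close>.\<close>
    have "c (Suc k) = ?d \<otimes> s (Suc k) \<otimes> inv ?d"
      using k step.IH c_step[of "Suc k"] braided_conj_swap[OF cl(2,3)] by simp
    moreover have "?d \<otimes> s k \<otimes> inv ?d = s k"
      using cl k by (intro conj_inv_commuting s_c_commute[symmetric]) auto
    ultimately show ?case
      using braided_conj[of "inv ?d" "s k" "s (Suc k)"] s_braided[of k] cl k by simp
  qed
qed

lemma c_eq_conj_s:
  assumes "1 \<le> k" "k < n"
  shows "c k = c (Suc k) \<otimes> s k \<otimes> inv c (Suc k)"
  using assms by (simp add: c_step braided_conj_swap s_c_braided s_closed c_closed)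

lemma c_braided_less:
  assumes "1 \<le> i" "i < j" "j \<le> n"
  shows "braided G (c i) (c j)"
proof -
  have "i \<le> j - 1"
    using assms by simp
  then show ?thesis
    using assms(1)
  proof (induction i rule: inc_induct)
    case base
    define k where "k = j - 1"
    have k: "j = Suc k" "1 \<le> k" "k < n"
      using base assms by (auto simp: k_def)
    then have cl: "s k \<in> carrier G" "c j \<in> carrier G"
      by (auto intro: s_closed c_closed)
    \<comment> \<open>Conjugation by \<open>c j\<close> fixes \<open>c j\<close> and takes
      \<open>s k\<close> to \<open>c k\<close>, so it carries the braid relation of
      \<open>s k\<close> and \<open>c j\<close> to the one wanted.\<close>
    have "c j \<otimes> c j \<otimes> inv c j = c j"
      using cl by (simp add: m_assoc)
    then have "braided G (c k) (c j)"
      using braided_conj[of "inv c j" "s k" "c j"] s_c_braided[of k] c_eq_conj_s[of k] cl k by simp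
    then show ?case
      by (simp add: k_def)
  next
    case (step i)
    have cl: "s i \<in> carrier G" "c (Suc i) \<in> carrier G" "c j \<in> carrier G"
      using step assms by (auto intro: s_closed c_closed)
    have "inv s i \<otimes> c j \<otimes> s i = c j"
      using cl step assms by (intro conj_commuting s_c_commute) auto
    then show ?case
      using braided_conj[of "s i" "c (Suc i)" "c j"] cl step assms by (simp add: c_step)
  qed
qed

lemma c_braided:
  assumes "i \<in> {1..n}" "j \<in> {1..n}" "i \<noteq> j"
  shows "braided G (c i) (c j)"
  using assms c_braided_less[of i j] c_braided_less[of j i] braided_sym
  by (cases i j rule: linorder_cases) auto

lemma s_in_subgroup:
  assumes H: "subgroup H G" "c ` {1..n} \<subseteq> H" and k: "k \<in> {1..n}"
  shows "s k \<in> H"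
\<comment> \<open>The top index stands apart: \<open>s n\<close> is itself \<open>c n\<close>, while
  below it \<open>s k\<close> is recovered from \<open>c k\<close> and
  \<open>c (Suc k)\<close>.\<close>
proof (cases "k = n")
  case True
  then have "c n \<in> H" using H(2) k by auto
  then show ?thesis using True by (simp add: c_last)
next
  case False
  then have cl: "s k \<in> carrier G" "c (Suc k) \<in> carrier G" and kn: "1 \<le> k" "k < n"
    using k by (auto intro: s_closed c_closed)
  have "inv c (Suc k) \<otimes> c k \<otimes> c (Suc k) = s k"
    using cl kn by (simp add: c_eq_conj_s m_assoc inv_mult_cancel)
  moreover have "c k \<in> H" "c (Suc k) \<in> H"
    using H(2) kn by auto
  ultimately show ?thesis
    using H(1) by (metis subgroup.m_closed subgroup.m_inv_closed)
qed

end

section \<open>The braid group as an instance, and the homomorphism onto it\<close>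

lemma braid_generators_B_A: "braid_generators (B_A n) n (A_gen n) (c_elt n)"
proof -
  interpret group "B_A n" by (rule group_B_A)
  have cl: "A_gen n k \<in> carrier (B_A n)" if "k \<in> {1..n}" for k
    using that by (simp add: A_gen_def B_A_def gen_closed)
  have rel: "word_val (B_A n) (A_gen n) u = word_val (B_A n) (A_gen n) v"
    if "(u, v) \<in> A_relations n" "u \<in> words {1..n}" "v \<in> words {1..n}" for u v
    using presented_group_relation[OF that] by (simp add: A_gen_def[abs_def] B_A_def)
  show ?thesis
  proof
    show "braided (B_A n) (A_gen n k) (A_gen n (Suc k))" if "1 \<le> k" "k < n" for k
      using rel[of "[Pos k, Pos (Suc k), Pos k]" "[Pos (Suc k), Pos k, Pos (Suc k)]"] that
      by (simp add: A_relations_def braided_def cl m_assoc)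
    show "A_gen n i \<otimes>\<^bsub>B_A n\<^esub> A_gen n j = A_gen n j \<otimes>\<^bsub>B_A n\<^esub> A_gen n i"
      if "1 \<le> i" "Suc i < j" "j \<le> n" for i j
      using rel[of "[Pos i, Pos j]" "[Pos j, Pos i]"] that
      by (simp add: A_relations_def cl)
  \<comment> \<open>The recursion of \<open>c_elt\<close> stops at \<open>k \<ge> n\<close>: this
    gives \<open>c_last\<close> at \<open>k = n\<close> and \<open>c_step\<close> below.\<close>
  qed (simp_all add: cl c_elt.simps[of n])
qed

text \<open>That the assignment defines a homomorphism is read as existence with uniqueness, the
  latter on the carrier because a HOL function is arbitrary outside it.\<close>

theorem proposition4p3:
  fixes n :: nat
  assumes "n \<ge> 1"
  shows "\<exists>\<eta>. group_hom (B_K n) (B_A n) \<eta>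
    \<and> (\<forall>i\<in>{1..n}. \<eta> (K_gen n i) = c_elt n i)
    \<and> \<eta> ` carrier (B_K n) = carrier (B_A n)
    \<and> (\<forall>\<eta>'. group_hom (B_K n) (B_A n) \<eta>' \<and> (\<forall>i\<in>{1..n}. \<eta>' (K_gen n i) = c_elt n i)
           \<longrightarrow> (\<forall>x\<in>carrier (B_K n). \<eta>' x = \<eta> x))"
proof -
  interpret braid_generators "B_A n" n "A_gen n" "c_elt n"
    by (rule braid_generators_B_A)
  have c: "c_elt n ` {1..n} \<subseteq> carrier (B_A n)"
    using c_closed by auto
  have "word_val (B_A n) (c_elt n) u = word_val (B_A n) (c_elt n) v" if "(u, v) \<in> K_relations n" for u v
    using that c_braided c_closed by (auto simp: K_relations_def braided_def m_assoc)
  then obtain \<eta> where hom: "group_hom (B_K n) (B_A n) \<eta>"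
    and gens: "\<And>i. i \<in> {1..n} \<Longrightarrow> \<eta> (K_gen n i) = c_elt n i"
    using presented_group_lift[OF c] unfolding B_K_def K_gen_def by metis
  have "\<eta> (K_gen n i) \<in> \<eta> ` carrier (B_K n)" if "i \<in> {1..n}" for i
    using that by (simp add: B_K_def K_gen_def gen_closed)
  then have "c_elt n ` {1..n} \<subseteq> \<eta> ` carrier (B_K n)"
    using gens by auto
  \<comment> \<open>The image is a subgroup containing every c_i, hence every \<sigma>_i, and these
    generate the braid group.\<close>
  then have "A_gen n ` {1..n} \<subseteq> \<eta> ` carrier (B_K n)"
    using s_in_subgroup group_hom.img_is_subgroup[OF hom] by blast
  then have surj: "\<eta> ` carrier (B_K n) = carrier (B_A n)"
    using group_hom.img_is_subgroup[OF hom] unfolding B_A_def A_gen_def[abs_def]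
    by (intro subgroup_presented_group_eqI)
  have "\<eta>' x = \<eta> x" if hom': "group_hom (B_K n) (B_A n) \<eta>'"
    and gens': "\<forall>i\<in>{1..n}. \<eta>' (K_gen n i) = c_elt n i" and x: "x \<in> carrier (B_K n)" for \<eta>' x
  proof (rule presented_group_hom_eqI[OF hom'[unfolded B_K_def] hom[unfolded B_K_def] _ x[unfolded B_K_def]])
    fix i assume "i \<in> {1..n}"
    then show "\<eta>' (gen {1..n} (K_relations n) i) = \<eta> (gen {1..n} (K_relations n) i)"
      using gens[of i] gens' unfolding K_gen_def by metis
  qed
  then show ?thesis
    using hom gens surj by blast
qed

end
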